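(* Let $1<p<\infty$ and let $\lambda,\alpha,\beta,\varphi,\psi$ be real numbers. Then the operator $\mathbf{H}_{\lambda,\alpha,\beta}$ is bounded from $l_{\varphi}^p$ to $L_{\psi}^1$ if and only if both $$\lambda>\alpha+\beta+2+\psi-\frac{\varphi+1}{p}\qquad\text{and}\qquad -\beta<\psi+1<\lambda-\beta$$ hold.
   Context: Let $\mathbb{R}_{+}=(0,+\infty)$ and $\mathbb{N}=\{1,2,3,\dots\}$. For real $\lambda,\alpha,\beta$ and a real sequence $a=\{a_m\}_{m=1}^{\infty}$, define $$\mathbf{H}_{\lambda,\alpha,\beta}a(x):=\sum_{m=1}^{\infty}\frac{m^{\alpha}x^{\beta}}{[\max\{m,x\}]^{\lambda}}a_m,\quad x\in\mathbb{R}_{+}.$$ For $1\le p<\infty$ and $\theta\in\mathbb{R}$, $l_\theta^p$ is the space of real sequences with $\|a\|_{p,\theta}=(\sum_{n=1}^\infty n^\theta|a_n|^p)^{1/p}<\infty$, and $L_\theta^p$ is the space of real-valued measurable functions $f$ on $\mathbb{R}_{+}$ with $\|f\|_{p,\theta}=(\int_{\mathbb{R}_{+}}|f(x)|^p x^\theta\,dx)^{1/p}<\infty$. The operator is bounded from a sequence space $X$ to a function space $Y$ if for every $a\in X$ the defining series converges for a.e. $x\in\mathbb{R}_{+}$ and there is a constant $C$ with $\|\mathbf{H}_{\lambda,\alpha,\beta}a\|_Y\le C\|a\|_X$ for all $a\in X$. *)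

theory Defs
  imports "HOL-Analysis.Analysis"
begin

text \<open>
  A sequence indexed by the positive integers is a function \<open>a :: nat \<Rightarrow> real\<close> whose
  value at \<open>0\<close> is never used: all series below run over \<open>Suc n\<close>.
\<close>

definition seq_space :: "real \<Rightarrow> real \<Rightarrow> (nat \<Rightarrow> real) set" where
  "seq_space p \<theta> = {a. summable (\<lambda>n. real (Suc n) powr \<theta> * \<bar>a (Suc n)\<bar> powr p)}"

definition seq_norm :: "real \<Rightarrow> real \<Rightarrow> (nat \<Rightarrow> real) \<Rightarrow> real" where
  "seq_norm p \<theta> a = (\<Sum>n. real (Suc n) powr \<theta> * \<bar>a (Suc n)\<bar> powr p) powr (1 / p)"

abbreviation pos_measure :: "real measure" where
  "pos_measure \<equiv> lebesgue_on {0<..}"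

definition fun_space :: "real \<Rightarrow> real \<Rightarrow> (real \<Rightarrow> real) set" where
  "fun_space p \<theta> = {f. f \<in> borel_measurable pos_measure \<and>
     integrable pos_measure (\<lambda>x. \<bar>f x\<bar> powr p * x powr \<theta>)}"

definition fun_norm :: "real \<Rightarrow> real \<Rightarrow> (real \<Rightarrow> real) \<Rightarrow> real" where
  "fun_norm p \<theta> f = (LINT x|pos_measure. \<bar>f x\<bar> powr p * x powr \<theta>) powr (1 / p)"

definition H_term ::
  "real \<Rightarrow> real \<Rightarrow> real \<Rightarrow> (nat \<Rightarrow> real) \<Rightarrow> real \<Rightarrow> nat \<Rightarrow> real" where
  "H_term lam \<alpha> \<beta> a x m =
     real m powr \<alpha> * x powr \<beta> / (max (real m) x) powr lam * a m"

definition H_op ::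
  "real \<Rightarrow> real \<Rightarrow> real \<Rightarrow> (nat \<Rightarrow> real) \<Rightarrow> real \<Rightarrow> real" where
  "H_op lam \<alpha> \<beta> a x = (\<Sum>n. H_term lam \<alpha> \<beta> a x (Suc n))"

text \<open>
  Since \<open>suminf\<close> is total, convergence of the defining series is demanded explicitly.
  Likewise \<open>fun_norm\<close> is total (a divergent integral is \<open>0\<close>), so finiteness of the norm of
  the image is the membership in \<open>fun_space\<close>.
\<close>

definition H_bounded ::
  "real \<Rightarrow> real \<Rightarrow> real \<Rightarrow> real \<Rightarrow> real \<Rightarrow> real \<Rightarrow> real \<Rightarrow> bool" where
  "H_bounded lam \<alpha> \<beta> p \<phi> q \<psi> \<longleftrightarrow>
     (\<forall>a \<in> seq_space p \<phi>.
        (AE x in pos_measure. summable (\<lambda>n. H_term lam \<alpha> \<beta> a x (Suc n))) \<and>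
        H_op lam \<alpha> \<beta> a \<in> fun_space q \<psi>) \<and>
     (\<exists>C. \<forall>a \<in> seq_space p \<phi>.
        fun_norm q \<psi> (H_op lam \<alpha> \<beta> a) \<le> C * seq_norm p \<phi> a)"

end

theory Submission
  imports Defs
begin

text \<open>
  The target norm is an \<open>L\<^sup>1\<close> norm, so for a nonnegative sequence \<open>a\<close> Tonelli's theorem evaluates
  it exactly. Put \<open>s = \<beta> + \<psi>\<close>. The \<open>m\<close>-th term contributes \<open>m\<^sup>\<alpha> a\<^sub>m\<close> times the integral over
  \<open>(0, \<infinity>)\<close> of \<open>x powr s / max m x powr lam\<close>. This integral converges at \<open>0\<close> iff \<open>- 1 < s\<close> and at
  infinity iff \<open>s + 1 < lam\<close>, and by homogeneity it is then a constant times
  \<open>m powr (s + 1 - lam)\<close> (\<open>max_kernel_integral\<close>). Hence, writing \<open>\<gamma> = \<alpha> + \<beta> + \<psi> + 1 - lam\<close>, the norm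
  of the image is a positive constant times the sum of \<open>m powr \<gamma> * a m\<close> (\<open>H_op_L1\<close>).

  Boundedness therefore says that the kernel is integrable and that \<open>m powr \<gamma>\<close> defines a bounded
  functional on the weighted \<open>l\<^sup>p\<close> space. By duality the latter means that
  \<open>m powr (\<gamma> - \<phi> / p)\<close> lies in \<open>l\<^sup>q\<close> for the conjugate exponent \<open>q\<close>, i.e. that
  \<open>q * (\<gamma> - \<phi> / p) < - 1\<close>, which is \<open>\<gamma> < (\<phi> + 1) / p - 1\<close>: the first inequality of the criterion.
  Sufficiency is the Hoelder inequality (\<open>weighted_Holder\<close>). For necessity, the unit sequence
  at \<open>m = 1\<close> forces integrability of the kernel (\<open>max_kernel_integrable_imp\<close>), and truncations of
  the power extremal in the Hoelder inequality force the bound on \<open>\<gamma>\<close>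
  (\<open>weighted_Holder_converse\<close>).
\<close>

section \<open>The mass of the kernel\<close>

text \<open>
  The integral of \<open>x powr s / max 1 x powr lam\<close> over \<open>(0, \<infinity>)\<close> when
  \<open>- 1 < s\<close> and \<open>s + 1 < lam\<close>: the first summand comes from \<open>(0, 1)\<close>, the second from \<open>(1, \<infinity>)\<close>.
\<close>

definition kernel_mass :: "real \<Rightarrow> real \<Rightarrow> real" where
  "kernel_mass s lam = 1 / (s + 1) + 1 / (lam - s - 1)"

lemma kernel_mass_pos: "- 1 < s \<Longrightarrow> s + 1 < lam \<Longrightarrow> kernel_mass s lam > 0"
  unfolding kernel_mass_def by (intro add_pos_pos) auto

text \<open>
  The kernel is \<open>m powr (- lam) * x powr s\<close> to the left of \<open>m\<close> and \<open>x powr (s - lam)\<close> to the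
  right, and the two power integrals scale with the same power of \<open>m\<close>.
\<close>

lemma has_integral_max_kernel:
  fixes m s lam :: real
  assumes m: "0 < m" and s: "- 1 < s" "s + 1 < lam"
  shows "((\<lambda>x. x powr s / max m x powr lam) has_integral
           kernel_mass s lam * m powr (s + 1 - lam)) {0<..}"
proof -
  let ?f = "\<lambda>x::real. x powr s / max m x powr lam"
  have "((\<lambda>x. inverse (m powr lam) * x powr s) has_integral
          inverse (m powr lam) * (m powr (s + 1) / (s + 1))) {0..m}"
    using has_integral_powr_from_0[of s m] m s by (intro has_integral_mult_right) auto
  then have near: "(?f has_integral inverse (m powr lam) * (m powr (s + 1) / (s + 1))) {0..m}"
    by (rule has_integral_eq[rotated]) (auto simp: max_def divide_inverse)
  have "((\<lambda>x. x powr (s - lam)) has_integral - (m powr (s - lam + 1)) / (s - lam + 1)) {m..}"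
    using has_integral_powr_to_inf[of "s - lam" m] m s by auto
  then have far: "(?f has_integral - (m powr (s - lam + 1)) / (s - lam + 1)) {m..}"
    by (rule has_integral_eq[rotated]) (use m in \<open>auto simp: max_def powr_diff\<close>)
  have "{0..m} \<inter> {m..} = {m}"
    using m by auto
  then have "(?f has_integral inverse (m powr lam) * (m powr (s + 1) / (s + 1))
               + - (m powr (s - lam + 1)) / (s - lam + 1)) ({0..m} \<union> {m..})"
    using has_integral_Un[OF near far] by simp
  moreover have "{0..m} \<union> {m..} = {0..}"
    using m by auto
  moreover have "inverse (m powr lam) * (m powr (s + 1) / (s + 1))
                   + - (m powr (s - lam + 1)) / (s - lam + 1)
                 = kernel_mass s lam * m powr (s + 1 - lam)"
  proof -
    have "inverse (m powr lam) * m powr (s + 1) = m powr (s + 1 - lam)"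
      by (simp add: powr_diff divide_inverse mult.commute)
    moreover have "- (m powr (s - lam + 1)) / (s - lam + 1) = m powr (s + 1 - lam) / (lam - s - 1)"
      using minus_divide_divide[of "m powr (s + 1 - lam)" "lam - s - 1"] by (simp add: algebra_simps)
    moreover have "inverse (m powr lam) * (m powr (s + 1) / (s + 1))
                     = inverse (m powr lam) * m powr (s + 1) / (s + 1)"
      by simp
    ultimately show ?thesis
      by (simp only: kernel_mass_def distrib_right times_divide_eq_left mult_1_left)
  qed
  ultimately have "(?f has_integral kernel_mass s lam * m powr (s + 1 - lam)) {0..}"
    by simp
  \<comment> \<open>The integrand vanishes at the extra point \<open>0\<close>, since \<open>0 powr s = 0\<close> even for \<open>s \<le> 0\<close>.\<close>
  moreover have "(?f has_integral I) {0..} \<longleftrightarrow> (?f has_integral I) {0<..}" for I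
    by (intro has_integral_spike_set_eq empty_imp_negligible) auto
  ultimately show ?thesis
    by blast
qed

lemma max_kernel_integral:
  fixes m s lam :: real
  assumes m: "0 < m" and s: "- 1 < s" "s + 1 < lam"
  shows "integrable pos_measure (\<lambda>x. x powr s / max m x powr lam)"
    and "(LINT x|pos_measure. x powr s / max m x powr lam)
           = kernel_mass s lam * m powr (s + 1 - lam)"
proof -
  let ?f = "\<lambda>x::real. x powr s / max m x powr lam"
  have "?f absolutely_integrable_on {0<..}"
    by (rule nonnegative_absolutely_integrable_1)
       (use has_integral_max_kernel[OF assms] in \<open>auto simp: integrable_on_def\<close>)
  then show int: "integrable pos_measure ?f"
    by (rule absolutely_integrable_imp_integrable) auto
  show "(LINT x|pos_measure. ?f x) = kernel_mass s lam * m powr (s + 1 - lam)"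
    using lebesgue_integral_eq_integral[OF int] has_integral_max_kernel[OF assms]
    by (simp add: integral_unique)
qed

text \<open>
  Quantifies the divergence of the integral of \<open>1 / x\<close> at both ends of the half-line: the
  right-hand side does not depend on \<open>a\<close> and \<open>b\<close>.
\<close>

lemma ln_diff_le_integral:
  fixes f :: "real \<Rightarrow> real"
  assumes f: "f integrable_on {0<..}" "\<And>x. 0 < x \<Longrightarrow> 0 \<le> f x"
    and ab: "0 < a" "a \<le> b"
    and ge: "\<And>x. a \<le> x \<Longrightarrow> x \<le> b \<Longrightarrow> inverse x \<le> f x"
  shows "ln b - ln a \<le> integral {0<..} f"
proof -
  have inv: "(inverse has_integral (ln b - ln a)) {a..b}"
    using ab by (intro fundamental_theorem_of_calculus)
      (auto intro!: derivative_eq_intros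
            simp: divide_inverse simp flip: has_real_derivative_iff_has_vector_derivative)
  have sub: "f integrable_on {a..b}"
    using f(1) by (rule integrable_on_subinterval) (use ab in auto)
  have "ln b - ln a \<le> integral {a..b} f"
    using inv integrable_integral[OF sub] by (rule has_integral_le) (use ge in auto)
  also have "\<dots> \<le> integral {0<..} f"
    using sub f by (intro integral_subset_le) (use ab in auto)
  finally show ?thesis .
qed

text \<open>
  If either inequality failed, the kernel would dominate \<open>1 / x\<close> on \<open>(0, 1]\<close> or on \<open>[1, \<infinity>)\<close>.
  An interval of logarithmic length exceeding the total integral by \<open>1\<close> gives the contradiction.
\<close>

lemma max_kernel_integrable_imp:
  fixes s lam :: real
  assumes "(\<lambda>x. x powr s / max 1 x powr lam) integrable_on {0<..}"
  shows "- 1 < s" and "s + 1 < lam"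
proof -
  let ?f = "\<lambda>x::real. x powr s / max 1 x powr lam"
  define I where "I = integral {0<..} ?f"
  have "0 \<le> I"
    unfolding I_def using assms by (intro integral_nonneg) auto
  note bound = ln_diff_le_integral[OF assms, folded I_def]
  show "- 1 < s"
  proof (rule ccontr)
    assume s: "\<not> - 1 < s"
    have "ln 1 - ln (exp (- (I + 1))) \<le> I"
    proof (rule bound)
      fix x :: real assume x: "exp (- (I + 1)) \<le> x" "x \<le> 1"
      then have "0 < x"
        using exp_gt_zero less_le_trans by blast
      then have "x powr (-1) \<le> x powr s"
        using s x by (intro powr_mono') auto
      then show "inverse x \<le> ?f x"
        using x \<open>0 < x\<close> by (simp add: max_def powr_minus)
    qed (use \<open>0 \<le> I\<close> in auto)
    then show False
      by simp
  qed
  show "s + 1 < lam"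
  proof (rule ccontr)
    assume s: "\<not> s + 1 < lam"
    have "ln (exp (I + 1)) - ln 1 \<le> I"
    proof (rule bound)
      fix x :: real assume x: "1 \<le> x" "x \<le> exp (I + 1)"
      then have "x powr (-1) \<le> x powr (s - lam)"
        using s by (intro powr_mono) auto
      then show "inverse x \<le> ?f x"
        using x by (simp add: max_def powr_minus powr_diff)
    qed (use \<open>0 \<le> I\<close> in auto)
    then show False
      by simp
  qed
qed

section \<open>The norm of the image\<close>

lemma H_term_borel [measurable]: "(\<lambda>x. H_term lam \<alpha> \<beta> a x m) \<in> borel_measurable pos_measure"
proof -
  have "(\<lambda>x. H_term lam \<alpha> \<beta> a x m) \<in> borel_measurable borel"
    unfolding H_term_def by measurable
  then have "(\<lambda>x. H_term lam \<alpha> \<beta> a x m) \<in> borel_measurable lebesgue"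
    by (intro measurable_completion) simp
  then show ?thesis
    by (rule measurable_restrict_space1)
qed

lemma H_op_borel: "H_op lam \<alpha> \<beta> a \<in> borel_measurable pos_measure"
  unfolding H_op_def[abs_def] by measurable

lemma H_term_weighted:
  assumes "x > 0"
  shows "H_term lam \<alpha> \<beta> a x m * x powr \<psi>
           = (real m powr \<alpha> * a m) * (x powr (\<beta> + \<psi>) / max (real m) x powr lam)"
  using assms by (simp add: H_term_def powr_add)

lemma H_term_weighted_integral:
  fixes m :: nat
  assumes s: "- 1 < \<beta> + \<psi>" "\<beta> + \<psi> + 1 < lam" and m: "0 < m"
  shows "integrable pos_measure (\<lambda>x. H_term lam \<alpha> \<beta> a x m * x powr \<psi>)"
    and "(LINT x|pos_measure. H_term lam \<alpha> \<beta> a x m * x powr \<psi>)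
           = kernel_mass (\<beta> + \<psi>) lam * (real m powr (\<alpha> + \<beta> + \<psi> + 1 - lam) * a m)"
    and "(LINT x|pos_measure. norm (H_term lam \<alpha> \<beta> a x m * x powr \<psi>))
           = kernel_mass (\<beta> + \<psi>) lam * (real m powr (\<alpha> + \<beta> + \<psi> + 1 - lam) * \<bar>a m\<bar>)"
proof -
  let ?k = "\<lambda>x. x powr (\<beta> + \<psi>) / max (real m) x powr lam"
  have m': "0 < real m"
    using m by simp
  note k = max_kernel_integral[OF m' s]
  have pow: "real m powr \<alpha> * real m powr (\<beta> + \<psi> + 1 - lam)
             = real m powr (\<alpha> + \<beta> + \<psi> + 1 - lam)"
    by (simp flip: powr_add add: algebra_simps)
  have "integrable pos_measure (\<lambda>x. (real m powr \<alpha> * a m) * ?k x)"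
    using k(1) by (rule integrable_mult_right)
  then show "integrable pos_measure (\<lambda>x. H_term lam \<alpha> \<beta> a x m * x powr \<psi>)"
    by (rule Bochner_Integration.integrable_cong[OF refl, THEN iffD1, rotated])
       (simp add: H_term_weighted)
  have "(LINT x|pos_measure. H_term lam \<alpha> \<beta> a x m * x powr \<psi>)
          = (LINT x|pos_measure. (real m powr \<alpha> * a m) * ?k x)"
    by (rule Bochner_Integration.integral_cong) (simp_all add: H_term_weighted)
  also have "\<dots> = (real m powr \<alpha> * a m) * (kernel_mass (\<beta> + \<psi>) lam * real m powr (\<beta> + \<psi> + 1 - lam))"
    by (simp only: integral_mult_right_zero k(2))
  finally show "(LINT x|pos_measure. H_term lam \<alpha> \<beta> a x m * x powr \<psi>)
           = kernel_mass (\<beta> + \<psi>) lam * (real m powr (\<alpha> + \<beta> + \<psi> + 1 - lam) * a m)"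
    by (simp add: mult_ac flip: pow)
  have "(LINT x|pos_measure. norm (H_term lam \<alpha> \<beta> a x m * x powr \<psi>))
          = (LINT x|pos_measure. (real m powr \<alpha> * \<bar>a m\<bar>) * ?k x)"
    by (rule Bochner_Integration.integral_cong) (simp_all add: H_term_weighted abs_mult)
  also have "\<dots> = (real m powr \<alpha> * \<bar>a m\<bar>) * (kernel_mass (\<beta> + \<psi>) lam * real m powr (\<beta> + \<psi> + 1 - lam))"
    by (simp only: integral_mult_right_zero k(2))
  finally show "(LINT x|pos_measure. norm (H_term lam \<alpha> \<beta> a x m * x powr \<psi>))
           = kernel_mass (\<beta> + \<psi>) lam * (real m powr (\<alpha> + \<beta> + \<psi> + 1 - lam) * \<bar>a m\<bar>)"
    by (simp add: mult_ac flip: pow)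
qed

lemma fun_space_1_iff:
  "f \<in> fun_space 1 \<psi> \<longleftrightarrow>
     f \<in> borel_measurable pos_measure \<and> integrable pos_measure (\<lambda>x. \<bar>f x\<bar> * x powr \<psi>)"
  by (simp add: fun_space_def)

lemma fun_norm_1: "fun_norm 1 \<psi> f = (LINT x|pos_measure. \<bar>f x\<bar> * x powr \<psi>)"
proof -
  have "0 \<le> (LINT x|pos_measure. \<bar>f x\<bar> * x powr \<psi>)"
    by (rule integral_nonneg_AE) simp
  then show ?thesis
    by (simp add: fun_norm_def)
qed

text \<open>
  Only the tail \<open>m \<ge> x\<close> matters. There \<open>max m x\<close> is \<open>m\<close>, and \<open>\<alpha> - lam\<close> is at most the
  exponent \<open>\<alpha> + \<beta> + \<psi> + 1 - lam\<close> that governs the norm. So the defining series converges at every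
  positive \<open>x\<close>, not merely almost everywhere.
\<close>

lemma H_term_abs_summable:
  assumes s: "- 1 < \<beta> + \<psi>" and x: "0 < x"
    and sum: "summable (\<lambda>n. real (Suc n) powr (\<alpha> + \<beta> + \<psi> + 1 - lam) * \<bar>a (Suc n)\<bar>)"
  shows "summable (\<lambda>n. \<bar>H_term lam \<alpha> \<beta> a x (Suc n)\<bar>)"
proof (rule summable_comparison_test_ev)
  show "summable (\<lambda>n. x powr \<beta> * (real (Suc n) powr (\<alpha> + \<beta> + \<psi> + 1 - lam) * \<bar>a (Suc n)\<bar>))"
    using sum by (rule summable_mult)
  have "eventually (\<lambda>n. x \<le> real (Suc n)) sequentially"
    by (rule eventually_sequentiallyI[of "nat \<lceil>x\<rceil>"]) linarith
  then show "eventually (\<lambda>n. norm \<bar>H_term lam \<alpha> \<beta> a x (Suc n)\<bar>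
      \<le> x powr \<beta> * (real (Suc n) powr (\<alpha> + \<beta> + \<psi> + 1 - lam) * \<bar>a (Suc n)\<bar>)) sequentially"
  proof eventually_elim
    case (elim n)
    define m where "m = real (Suc n)"
    have m: "1 \<le> m" "x \<le> m"
      using elim by (auto simp: m_def)
    have "norm \<bar>H_term lam \<alpha> \<beta> a x (Suc n)\<bar> = x powr \<beta> * (m powr (\<alpha> - lam) * \<bar>a (Suc n)\<bar>)"
      using m x by (simp add: H_term_def abs_mult powr_diff max_absorb1 flip: m_def del: of_nat_Suc)
    also have "\<dots> \<le> x powr \<beta> * (m powr (\<alpha> + \<beta> + \<psi> + 1 - lam) * \<bar>a (Suc n)\<bar>)"
      using s m by (intro mult_left_mono mult_right_mono powr_mono) auto
    finally show ?case
      by (simp only: m_def)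
  qed
qed

text \<open>
  Termwise integration of \<open>x powr \<psi>\<close> times the series for \<open>\<bar>a\<bar>\<close> gives an integrable majorant with known integral.
  It coincides with the weighted modulus of the image itself when \<open>a\<close> is nonnegative.
\<close>

lemma H_op_L1:
  fixes lam \<alpha> \<beta> \<psi> :: real and a :: "nat \<Rightarrow> real"
  defines "w \<equiv> \<lambda>m. real m powr (\<alpha> + \<beta> + \<psi> + 1 - lam)"
  assumes s: "- 1 < \<beta> + \<psi>" "\<beta> + \<psi> + 1 < lam"
    and sum: "summable (\<lambda>n. w (Suc n) * \<bar>a (Suc n)\<bar>)"
  shows "AE x in pos_measure. summable (\<lambda>n. H_term lam \<alpha> \<beta> a x (Suc n))"
    and "H_op lam \<alpha> \<beta> a \<in> fun_space 1 \<psi>"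
    and "fun_norm 1 \<psi> (H_op lam \<alpha> \<beta> a) \<le> kernel_mass (\<beta> + \<psi>) lam * (\<Sum>n. w (Suc n) * \<bar>a (Suc n)\<bar>)"
    and "(\<And>n. 0 \<le> a (Suc n)) \<Longrightarrow>
           fun_norm 1 \<psi> (H_op lam \<alpha> \<beta> a) = kernel_mass (\<beta> + \<psi>) lam * (\<Sum>n. w (Suc n) * a (Suc n))"
proof -
  let ?c = "kernel_mass (\<beta> + \<psi>) lam"
  let ?h = "\<lambda>n x. H_term lam \<alpha> \<beta> a x (Suc n) * x powr \<psi>"
  let ?b = "\<lambda>m. \<bar>a m\<bar>"
  let ?g = "\<lambda>n x. H_term lam \<alpha> \<beta> ?b x (Suc n) * x powr \<psi>"
  have c: "0 < ?c"
    using s by (rule kernel_mass_pos)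
  have abs: "summable (\<lambda>n. \<bar>H_term lam \<alpha> \<beta> a x (Suc n)\<bar>)" if "0 < x" for x
    using H_term_abs_summable[OF s(1) that] sum by (simp add: w_def)
  have Hb: "H_term lam \<alpha> \<beta> ?b x m = \<bar>H_term lam \<alpha> \<beta> a x m\<bar>" for x m
    by (simp add: H_term_def abs_mult)
  have conv: "AE x in pos_measure. summable (\<lambda>n. norm (?g n x))"
    by (rule AE_I2) (use abs in \<open>auto simp: Hb abs_mult intro!: summable_mult2\<close>)
  have int: "integrable pos_measure (?g n)" for n
    by (rule H_term_weighted_integral(1)[OF s]) simp
  have norms: "(LINT x|pos_measure. norm (?g n x)) = ?c * (w (Suc n) * \<bar>a (Suc n)\<bar>)" for n
    using H_term_weighted_integral(3)[OF s, of "Suc n" \<alpha> ?b] by (simp add: w_def)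
  have vals: "(LINT x|pos_measure. ?g n x) = ?c * (w (Suc n) * \<bar>a (Suc n)\<bar>)" for n
    using H_term_weighted_integral(2)[OF s, of "Suc n" \<alpha> ?b] by (simp add: w_def)
  have sumn: "summable (\<lambda>n. LINT x|pos_measure. norm (?g n x))"
    unfolding norms using sum by (rule summable_mult)
  have majint: "integrable pos_measure (\<lambda>x. \<Sum>n. ?g n x)"
    using int conv sumn by (rule integrable_suminf)
  have majval: "(LINT x|pos_measure. (\<Sum>n. ?g n x)) = ?c * (\<Sum>n. w (Suc n) * \<bar>a (Suc n)\<bar>)"
    using integral_suminf[OF int conv sumn] vals suminf_mult[OF sum, of ?c] by simp
  have maj: "(\<Sum>n. ?g n x) = H_op lam \<alpha> \<beta> ?b x * x powr \<psi>" if "0 < x" for x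
    unfolding H_op_def using suminf_mult2[of "\<lambda>n. H_term lam \<alpha> \<beta> ?b x (Suc n)" "x powr \<psi>"] abs[OF that]
    by (simp add: Hb)
  have le: "\<bar>H_op lam \<alpha> \<beta> a x\<bar> \<le> H_op lam \<alpha> \<beta> ?b x" if "0 < x" for x
    unfolding H_op_def Hb using summable_rabs[OF abs[OF that]] .
  have le': "\<bar>H_op lam \<alpha> \<beta> a x\<bar> * x powr \<psi> \<le> (\<Sum>n. ?g n x)" if "0 < x" for x
    unfolding maj[OF that] using le[OF that] by (rule mult_right_mono) simp
  have [measurable]: "(\<lambda>x. x powr \<psi>) \<in> borel_measurable pos_measure"
  proof -
    have "(\<lambda>x::real. x powr \<psi>) \<in> borel_measurable lebesgue"
      by (intro measurable_completion) simp
    then show ?thesis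
      by (rule measurable_restrict_space1)
  qed
  note H_op_borel[measurable]
  have absint: "integrable pos_measure (\<lambda>x. \<bar>H_op lam \<alpha> \<beta> a x\<bar> * x powr \<psi>)"
    using majint
  proof (rule Bochner_Integration.integrable_bound)
    show "AE x in pos_measure. norm (\<bar>H_op lam \<alpha> \<beta> a x\<bar> * x powr \<psi>) \<le> norm (\<Sum>n. ?g n x)"
    proof (rule AE_I2)
      fix x assume "x \<in> space pos_measure"
      then show "norm (\<bar>H_op lam \<alpha> \<beta> a x\<bar> * x powr \<psi>) \<le> norm (\<Sum>n. ?g n x)"
        using order_trans[OF le' abs_ge_self, of x] by simp
    qed
  qed measurable
  then show "H_op lam \<alpha> \<beta> a \<in> fun_space 1 \<psi>"
    by (simp add: fun_space_1_iff H_op_borel)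
  show "AE x in pos_measure. summable (\<lambda>n. H_term lam \<alpha> \<beta> a x (Suc n))"
    by (rule AE_I2) (use abs in \<open>auto intro: summable_rabs_cancel\<close>)
  show "fun_norm 1 \<psi> (H_op lam \<alpha> \<beta> a) \<le> ?c * (\<Sum>n. w (Suc n) * \<bar>a (Suc n)\<bar>)"
    unfolding fun_norm_1 majval[symmetric]
    using absint majint by (rule integral_mono) (use le' in auto)
  assume nonneg: "\<And>n. 0 \<le> a (Suc n)"
  have "\<bar>H_op lam \<alpha> \<beta> a x\<bar> * x powr \<psi> = (\<Sum>n. ?g n x)" if "0 < x" for x
  proof -
    have "H_op lam \<alpha> \<beta> a x = H_op lam \<alpha> \<beta> ?b x"
      using nonneg by (simp add: H_op_def H_term_def)
    then show ?thesis
      using le[OF that] by (simp add: maj[OF that])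
  qed
  then have "(LINT x|pos_measure. \<bar>H_op lam \<alpha> \<beta> a x\<bar> * x powr \<psi>)
               = (LINT x|pos_measure. (\<Sum>n. ?g n x))"
    by (intro Bochner_Integration.integral_cong) auto
  then show "fun_norm 1 \<psi> (H_op lam \<alpha> \<beta> a) = ?c * (\<Sum>n. w (Suc n) * a (Suc n))"
    using nonneg by (simp add: fun_norm_1 majval)
qed

section \<open>Duality between weighted sequence spaces\<close>

text \<open>
  Young's inequality, summed after normalising \<open>u\<close> and \<open>v\<close> by their norms. When one of the norms is
  \<open>0\<close>, so that this is impossible, all products vanish.
\<close>

lemma Holder_suminf:
  fixes u v :: "nat \<Rightarrow> real"
  assumes pq: "1 < p" "1 < q" "1 / p + 1 / q = 1"
    and nonneg: "\<And>n. 0 \<le> u n" "\<And>n. 0 \<le> v n"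
    and su: "summable (\<lambda>n. u n powr p)" and sv: "summable (\<lambda>n. v n powr q)"
  shows "summable (\<lambda>n. u n * v n)"
    and "(\<Sum>n. u n * v n) \<le> (\<Sum>n. u n powr p) powr (1 / p) * (\<Sum>n. v n powr q) powr (1 / q)"
proof -
  show uv: "summable (\<lambda>n. u n * v n)"
  proof (rule summable_comparison_test')
    show "summable (\<lambda>n. u n powr p / p + v n powr q / q)"
      using su sv by (intro summable_add summable_divide)
    show "norm (u n * v n) \<le> u n powr p / p + v n powr q / q" for n
      using Youngs_inequality[OF pq] nonneg by (simp add: abs_mult)
  qed
  define U where "U = (\<Sum>n. u n powr p)"
  define V where "V = (\<Sum>n. v n powr q)"
  have UV: "0 \<le> U" "0 \<le> V"
    unfolding U_def V_def using su sv by (auto intro: suminf_nonneg)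
  show "(\<Sum>n. u n * v n) \<le> U powr (1 / p) * V powr (1 / q)"
  proof (cases "U = 0 \<or> V = 0")
    case True
    then have "u n = 0 \<or> v n = 0" for n
      using suminf_eq_zero_iff[OF su] suminf_eq_zero_iff[OF sv] by (auto simp: U_def V_def)
    then have "(\<lambda>n. u n * v n) = (\<lambda>n. 0)"
      by auto
    then show ?thesis
      by simp
  next
    case False
    then have pos: "0 < U" "0 < V"
      using UV by auto
    define A where "A = U powr (1 / p)"
    define B where "B = V powr (1 / q)"
    have AB: "0 < A" "0 < B" "A powr p = U" "B powr q = V"
      using pos pq by (auto simp: A_def B_def powr_powr)
    have "u n * v n / (A * B) \<le> u n powr p / U / p + v n powr q / V / q" for n
      using Youngs_inequality[OF pq, of "u n / A" "v n / B"] nonneg[of n] AB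
      by (simp add: powr_divide)
    then have "(\<Sum>n. u n * v n / (A * B)) \<le> (\<Sum>n. u n powr p / U / p + v n powr q / V / q)"
      using uv su sv by (intro suminf_le summable_add summable_divide)
    also have "\<dots> = U / U / p + V / V / q"
      using su sv by (simp add: U_def V_def suminf_divide summable_divide flip: suminf_add)
    also have "\<dots> = 1"
      using pos pq by simp
    finally show ?thesis
      using AB uv by (simp add: suminf_divide pos_divide_le_eq flip: A_def B_def)
  qed
qed

lemma summable_Suc_powr_iff: "summable (\<lambda>n. real (Suc n) powr e) \<longleftrightarrow> e < - 1"
  using summable_Suc_iff[of "\<lambda>n. real n powr e"] summable_real_powr_iff[of e] by simp

text \<open>
  Split \<open>m powr \<gamma> * \<bar>a m\<bar>\<close> as \<open>m powr (\<phi> / p) * \<bar>a m\<bar>\<close>, whose \<open>l\<^sup>p\<close> norm is the weighted norm of \<open>a\<close>,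
  times \<open>m powr (\<gamma> - \<phi> / p)\<close>; the hypothesis on \<open>\<gamma>\<close> says exactly that the latter is in \<open>l\<^sup>q\<close>.
\<close>

lemma weighted_Holder:
  fixes p \<phi> \<gamma> :: real
  assumes p: "1 < p" and \<gamma>: "\<gamma> < (\<phi> + 1) / p - 1"
  shows "\<exists>K. \<forall>a \<in> seq_space p \<phi>.
           summable (\<lambda>n. real (Suc n) powr \<gamma> * \<bar>a (Suc n)\<bar>) \<and>
           (\<Sum>n. real (Suc n) powr \<gamma> * \<bar>a (Suc n)\<bar>) \<le> K * seq_norm p \<phi> a"
proof -
  define q where "q = p / (p - 1)"
  have pq: "1 < p" "1 < q" "1 / p + 1 / q = 1"
    using p by (auto simp: q_def field_simps)
  define v where "v = (\<lambda>n. real (Suc n) powr (\<gamma> - \<phi> / p))"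
  have "\<gamma> - \<phi> / p < - ((p - 1) / p)"
    using \<gamma> p by (simp add: add_divide_distrib diff_divide_distrib)
  then have "q * (\<gamma> - \<phi> / p) < q * (- ((p - 1) / p))"
    using pq by (intro mult_strict_left_mono) auto
  also have "\<dots> = - 1"
    using p by (simp add: q_def)
  finally have "(\<gamma> - \<phi> / p) * q < - 1"
    by (simp add: mult.commute)
  then have sv: "summable (\<lambda>n. v n powr q)"
    unfolding v_def powr_powr summable_Suc_powr_iff .
  have "summable (\<lambda>n. real (Suc n) powr \<gamma> * \<bar>a (Suc n)\<bar>)
      \<and> (\<Sum>n. real (Suc n) powr \<gamma> * \<bar>a (Suc n)\<bar>) \<le> (\<Sum>n. v n powr q) powr (1 / q) * seq_norm p \<phi> a"
    if a: "a \<in> seq_space p \<phi>" for a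
  proof -
    define u where "u = (\<lambda>n. real (Suc n) powr (\<phi> / p) * \<bar>a (Suc n)\<bar>)"
    have up: "u n powr p = real (Suc n) powr \<phi> * \<bar>a (Suc n)\<bar> powr p" for n
      using p by (simp add: u_def powr_mult powr_powr)
    have uv: "u n * v n = real (Suc n) powr \<gamma> * \<bar>a (Suc n)\<bar>" for n
      by (simp add: u_def v_def powr_diff)
    have su: "summable (\<lambda>n. u n powr p)"
      using a by (simp add: up seq_space_def)
    have nn: "0 \<le> u n" "0 \<le> v n" for n
      by (auto simp: u_def v_def)
    show ?thesis
      using Holder_suminf[OF pq nn su sv] unfolding uv up seq_norm_def by (simp add: mult.commute)
  qed
  then show ?thesis
    by blast
qed

text \<open>
  Turns a self-referential estimate into an absolute bound: since \<open>1 / p < 1\<close>, the smaller power of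
  \<open>S\<close> can be absorbed on the left.
\<close>

lemma powr_self_bound:
  fixes S D p :: real
  assumes p: "1 < p" and S: "0 \<le> S" and le: "S \<le> D * S powr (1 / p)"
  shows "S \<le> D powr (p / (p - 1))"
proof (cases "S = 0")
  case False
  then have S: "0 < S"
    using S by simp
  have "S powr (1 - 1 / p) \<le> D"
    using S le by (simp add: powr_diff divide_le_eq)
  then have "(S powr (1 - 1 / p)) powr (p / (p - 1)) \<le> D powr (p / (p - 1))"
    using p by (intro powr_mono2) auto
  moreover have "(1 - 1 / p) * (p / (p - 1)) = 1"
    using p by (simp add: field_simps)
  ultimately show ?thesis
    using S by (simp only: powr_powr powr_one)
qed simp

text \<open>
  Test on truncations of \<open>m powr t\<close>, with \<open>t\<close> chosen so that the functional and the \<open>p\<close>-th power of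
  the norm become the same partial sum \<open>S\<close> of \<open>m powr (\<gamma> + t)\<close> (the equality case of the Hoelder inequality).
  Then \<open>S \<le> D * S powr (1 / p)\<close> bounds the partial sums, so that series converges. Truncation keeps
  the test sequences in the space whether or not it does.
\<close>

lemma weighted_Holder_converse:
  fixes p \<phi> \<gamma> D :: real
  assumes p: "1 < p"
    and bound: "\<And>N a. (\<And>m. 0 \<le> a m) \<Longrightarrow> (\<And>m. N < m \<Longrightarrow> a m = 0) \<Longrightarrow>
      (\<Sum>n. real (Suc n) powr \<gamma> * a (Suc n)) \<le> D * seq_norm p \<phi> a"
  shows "\<gamma> < (\<phi> + 1) / p - 1"
proof -
  define t where "t = (\<gamma> - \<phi>) / (p - 1)"
  have t: "\<phi> + t * p = \<gamma> + t"
    using p by (simp add: t_def field_simps)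
  have part: "(\<Sum>n<N. real (Suc n) powr (\<gamma> + t)) \<le> D powr (p / (p - 1))" for N
  proof -
    define a where "a = (\<lambda>m. if m \<le> N then real m powr t else 0)"
    let ?S = "\<Sum>n<N. real (Suc n) powr (\<gamma> + t)"
    have "(\<Sum>n. real (Suc n) powr \<gamma> * a (Suc n)) = (\<Sum>n<N. real (Suc n) powr \<gamma> * a (Suc n))"
      by (rule suminf_finite) (auto simp: a_def)
    also have "\<dots> = ?S"
      by (rule sum.cong) (auto simp: a_def powr_add)
    finally have lhs: "(\<Sum>n. real (Suc n) powr \<gamma> * a (Suc n)) = ?S" .
    have "(\<Sum>n. real (Suc n) powr \<phi> * \<bar>a (Suc n)\<bar> powr p)
            = (\<Sum>n<N. real (Suc n) powr \<phi> * \<bar>a (Suc n)\<bar> powr p)"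
      by (rule suminf_finite) (auto simp: a_def)
    also have "\<dots> = ?S"
      by (rule sum.cong) (auto simp: a_def powr_powr simp flip: powr_add t)
    finally have "seq_norm p \<phi> a = ?S powr (1 / p)"
      by (simp add: seq_norm_def)
    moreover have "0 \<le> a m" "N < m \<Longrightarrow> a m = 0" for m
      by (auto simp: a_def)
    ultimately have "?S \<le> D * ?S powr (1 / p)"
      using bound[of a N] unfolding lhs by metis
    then show ?thesis
      by (intro powr_self_bound p sum_nonneg) auto
  qed
  have "summable (\<lambda>n. real (Suc n) powr (\<gamma> + t))"
    by (rule summableI_nonneg_bounded[OF _ part]) simp
  then have "\<gamma> + t < - 1"
    by (simp only: summable_Suc_powr_iff)
  then have "(\<gamma> + t) * (p - 1) < - 1 * (p - 1)"
    using p by (intro mult_strict_right_mono) auto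
  moreover have "(\<gamma> + t) * (p - 1) = \<gamma> * p - \<phi>"
    using p by (simp add: t_def field_simps)
  ultimately show ?thesis
    using p by (simp add: field_simps)
qed

section \<open>The criterion\<close>

lemma finite_support_in_seq_space:
  assumes "\<And>m. N < m \<Longrightarrow> a m = 0"
  shows "a \<in> seq_space p \<phi>"
proof -
  have "summable (\<lambda>n. real (Suc n) powr \<phi> * \<bar>a (Suc n)\<bar> powr p)"
    by (rule summable_finite[of "{..<N}"]) (simp_all add: assms)
  then show ?thesis
    by (simp add: seq_space_def)
qed

lemma H_op_unit:
  "H_op lam \<alpha> \<beta> (\<lambda>m. if m = 1 then 1 else 0) x = x powr \<beta> / max 1 x powr lam"
proof -
  have "H_op lam \<alpha> \<beta> (\<lambda>m. if m = 1 then 1 else 0) x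
          = (\<Sum>n\<in>{0}. H_term lam \<alpha> \<beta> (\<lambda>m. if m = 1 then 1 else 0) x (Suc n))"
    unfolding H_op_def by (rule suminf_finite) (auto simp: H_term_def)
  then show ?thesis
    by (simp add: H_term_def)
qed

theorem theorem1p7:
  fixes p lam \<alpha> \<beta> \<phi> \<psi> :: real
  assumes "1 < p"
  shows "H_bounded lam \<alpha> \<beta> p \<phi> 1 \<psi> \<longleftrightarrow>
    (lam > \<alpha> + \<beta> + 2 + \<psi> - (\<phi> + 1) / p \<and>
     - \<beta> < \<psi> + 1 \<and> \<psi> + 1 < lam - \<beta>)"
proof
  define \<gamma> where "\<gamma> = \<alpha> + \<beta> + \<psi> + 1 - lam"
  assume H: "H_bounded lam \<alpha> \<beta> p \<phi> 1 \<psi>"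
  have unit: "(\<lambda>m. if m = 1 then 1 else 0) \<in> seq_space p \<phi>"
    by (rule finite_support_in_seq_space[of 1]) auto
  have "integrable pos_measure
      (\<lambda>x. \<bar>H_op lam \<alpha> \<beta> (\<lambda>m. if m = 1 then 1 else 0) x\<bar> * x powr \<psi>)"
    using bspec[OF conjunct1[OF H[unfolded H_bounded_def]] unit] unfolding fun_space_1_iff by blast
  then have "integrable pos_measure (\<lambda>x. x powr (\<beta> + \<psi>) / max 1 x powr lam)"
    unfolding H_op_unit
    by (rule Bochner_Integration.integrable_cong[OF refl, THEN iffD1, rotated])
       (simp add: powr_add)
  then have "(\<lambda>x. x powr (\<beta> + \<psi>) / max 1 x powr lam) integrable_on {0<..}"
    by (rule integrable_on_lebesgue_on) simp
  then have s: "- 1 < \<beta> + \<psi>" "\<beta> + \<psi> + 1 < lam"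
    by (rule max_kernel_integrable_imp)+
  note c = kernel_mass_pos[OF s]
  obtain C where C: "\<And>a. a \<in> seq_space p \<phi> \<Longrightarrow>
      fun_norm 1 \<psi> (H_op lam \<alpha> \<beta> a) \<le> C * seq_norm p \<phi> a"
    using H unfolding H_bounded_def by blast
  have "\<gamma> < (\<phi> + 1) / p - 1"
  proof (rule weighted_Holder_converse[OF assms])
    fix N and a :: "nat \<Rightarrow> real"
    assume a: "\<And>m. 0 \<le> a m" "\<And>m. N < m \<Longrightarrow> a m = 0"
    have "summable (\<lambda>n. real (Suc n) powr \<gamma> * \<bar>a (Suc n)\<bar>)"
      by (rule summable_finite[of "{..<N}"]) (simp_all add: a(2))
    then have "kernel_mass (\<beta> + \<psi>) lam * (\<Sum>n. real (Suc n) powr \<gamma> * a (Suc n))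
                 = fun_norm 1 \<psi> (H_op lam \<alpha> \<beta> a)"
      unfolding \<gamma>_def by (rule H_op_L1(4)[OF s, symmetric]) (rule a(1))
    also have "\<dots> \<le> C * seq_norm p \<phi> a"
      by (rule C, rule finite_support_in_seq_space, rule a(2))
    finally have "kernel_mass (\<beta> + \<psi>) lam * (\<Sum>n. real (Suc n) powr \<gamma> * a (Suc n))
                    \<le> C * seq_norm p \<phi> a" .
    then show "(\<Sum>n. real (Suc n) powr \<gamma> * a (Suc n))
                 \<le> C / kernel_mass (\<beta> + \<psi>) lam * seq_norm p \<phi> a"
      using c by (simp add: field_simps)
  qed
  then show "lam > \<alpha> + \<beta> + 2 + \<psi> - (\<phi> + 1) / p \<and> - \<beta> < \<psi> + 1 \<and> \<psi> + 1 < lam - \<beta>"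
    using s by (auto simp: \<gamma>_def)
next
  define \<gamma> where "\<gamma> = \<alpha> + \<beta> + \<psi> + 1 - lam"
  assume A: "lam > \<alpha> + \<beta> + 2 + \<psi> - (\<phi> + 1) / p \<and> - \<beta> < \<psi> + 1 \<and> \<psi> + 1 < lam - \<beta>"
  then have s: "- 1 < \<beta> + \<psi>" "\<beta> + \<psi> + 1 < lam" and \<gamma>: "\<gamma> < (\<phi> + 1) / p - 1"
    by (auto simp: \<gamma>_def)
  obtain K where K_bound: "\<forall>a \<in> seq_space p \<phi>.
      summable (\<lambda>n. real (Suc n) powr \<gamma> * \<bar>a (Suc n)\<bar>) \<and>
      (\<Sum>n. real (Suc n) powr \<gamma> * \<bar>a (Suc n)\<bar>) \<le> K * seq_norm p \<phi> a"
    using weighted_Holder[OF assms \<gamma>] ..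
  note sum = K_bound[THEN bspec, THEN conjunct1] and K = K_bound[THEN bspec, THEN conjunct2]
  note L1 = H_op_L1[OF s, of \<alpha>, folded \<gamma>_def]
  have "fun_norm 1 \<psi> (H_op lam \<alpha> \<beta> a) \<le> kernel_mass (\<beta> + \<psi>) lam * K * seq_norm p \<phi> a"
    if a: "a \<in> seq_space p \<phi>" for a
  proof -
    have "fun_norm 1 \<psi> (H_op lam \<alpha> \<beta> a)
        \<le> kernel_mass (\<beta> + \<psi>) lam * (\<Sum>n. real (Suc n) powr \<gamma> * \<bar>a (Suc n)\<bar>)"
      by (rule L1(3)[OF sum[OF a]])
    also have "\<dots> \<le> kernel_mass (\<beta> + \<psi>) lam * (K * seq_norm p \<phi> a)"
      using K[OF a] kernel_mass_pos[OF s] by (intro mult_left_mono) auto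
    finally show ?thesis
      by (simp add: mult.assoc)
  qed
  note bound = this
  show "H_bounded lam \<alpha> \<beta> p \<phi> 1 \<psi>"
    unfolding H_bounded_def by (intro conjI ballI exI[of _ "kernel_mass (\<beta> + \<psi>) lam * K"] L1(1,2) sum bound)
qed

end
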